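(* Every ordered vector space $V$ admits a vector pricing. Moreover, if $V_0\subseteq V$ is any vector subspace of an ordered vector space $V$, endowed with the induced order, then every vector pricing $r_0$ on $V_0$ can be extended to a vector pricing $r$ on $V$, i.e. $r(u,v)=r_0(u,v)$ for all $u,v\in V_0^+$.
   Context: An ordered vector space is a real vector space $V$ with a partial order compatible with addition and with multiplication by positive scalars; $V^+=\{v\in V: v\geq 0\}$. A vector pricing on $V$ is a map $r\colon V^+\times V^+\to[0,+\infty]$ such that for all $u,v,w\in V^+$: (VP1) $r(u+v,w)=r(u,w)+r(v,w)$ when $w\neq 0$; (VP2) $r(u,w)=r(u,v)\,r(v,w)$ whenever the product on the right is defined; (VP3) $r(u,u)=1$. The usual arithmetic of $[0,+\infty]$ is used, and the only undefined operation is the product of $0$ and $+\infty$ (in either order). *)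

theory Defs
  imports Complex_Main "HOL-Library.Extended_Nonnegative_Real"
begin

definition pos_cone :: "'a::ordered_real_vector set \<Rightarrow> 'a set" where
  "pos_cone W = {v \<in> W. 0 \<le> v}"

(* The library sets 0 * top = 0 in ennreal, whereas here this product is undefined. *)
definition mult_defined :: "ennreal \<Rightarrow> ennreal \<Rightarrow> bool" where
  "mult_defined a b \<longleftrightarrow> \<not> (a = 0 \<and> b = top) \<and> \<not> (a = top \<and> b = 0)"

(* A vector pricing on W with the induced order. Only the restriction of r to
   pos_cone W \<times> pos_cone W matters; the values elsewhere are arbitrary. *)
definition vector_pricing_on ::
  "'a::ordered_real_vector set \<Rightarrow> ('a \<Rightarrow> 'a \<Rightarrow> ennreal) \<Rightarrow> bool" where
  "vector_pricing_on W r \<longleftrightarrow>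
     (\<forall>u \<in> pos_cone W. \<forall>v \<in> pos_cone W. \<forall>w \<in> pos_cone W.
        w \<noteq> 0 \<longrightarrow> r (u + v) w = r u w + r v w) \<and>
     (\<forall>u \<in> pos_cone W. \<forall>v \<in> pos_cone W. \<forall>w \<in> pos_cone W.
        mult_defined (r u v) (r v w) \<longrightarrow> r u w = r u v * r v w) \<and>
     (\<forall>u \<in> pos_cone W. r u u = 1)"

end

theory Submission imports Defs begin

text \<open>
  A total vector space order on \<open>V\<close> refining the given one yields a pricing, namely
  \<open>r u v = sup {t \<ge> 0. t v \<preceq> u}\<close>. Conversely, a pricing \<open>r\<^sub>0\<close> on \<open>V\<^sub>0\<close> forces every \<open>u - v\<close> with
  \<open>r\<^sub>0 u v > 1\<close> to be positive in any total order that induces it. These differences together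
  with \<open>V\<^sup>+\<close> generate a pointed cone, which Zorn's lemma enlarges to the positive cone of a total
  order. Comparing \<open>r\<^sub>0 u v\<close> with all positive reals shows that the pricing of this order extends \<open>r\<^sub>0\<close>.
\<close>

section \<open>Total cones\<close>

text \<open>These sets are the positive cones of the vector space orders
  \<open>y - x \<in> C\<close>; the last clause is antisymmetry.\<close>

definition pointed_cone :: "'a::real_vector set \<Rightarrow> bool" where
  "pointed_cone C \<longleftrightarrow> 0 \<in> C \<and> (\<forall>x\<in>C. \<forall>y\<in>C. x + y \<in> C) \<and>
     (\<forall>x\<in>C. \<forall>t>0. t *\<^sub>R x \<in> C) \<and> (\<forall>x\<in>C. - x \<in> C \<longrightarrow> x = 0)"

lemma pointed_cone_zero: "pointed_cone C \<Longrightarrow> 0 \<in> C"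
  and pointed_cone_add: "pointed_cone C \<Longrightarrow> x \<in> C \<Longrightarrow> y \<in> C \<Longrightarrow> x + y \<in> C"
  and pointed_cone_eq_zero: "pointed_cone C \<Longrightarrow> x \<in> C \<Longrightarrow> - x \<in> C \<Longrightarrow> x = 0"
  unfolding pointed_cone_def by auto

lemma pointed_cone_scaleR:
  assumes "pointed_cone C" "x \<in> C" "0 \<le> t" shows "t *\<^sub>R x \<in> C"
  using assms unfolding pointed_cone_def by (cases "t = 0") auto

text \<open>Only pointedness is at risk. Adding representations of \<open>y\<close> and
  \<open>- y\<close> gives \<open>(t + s) *\<^sub>R (- x) \<in> C\<close>, which puts
  \<open>- x\<close> into \<open>C\<close> unless \<open>t = s = 0\<close>.\<close>

lemma pointed_cone_insert_direction:
  assumes C: "pointed_cone C" and x: "- x \<notin> C"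
  shows "pointed_cone {c + t *\<^sub>R x | c t. c \<in> C \<and> 0 \<le> t}" (is "pointed_cone ?D")
  unfolding pointed_cone_def
proof (intro conjI ballI allI impI)
  show "0 \<in> ?D" using pointed_cone_zero[OF C] by force
next
  fix y z assume "y \<in> ?D" "z \<in> ?D"
  then obtain c t d s where "y = c + t *\<^sub>R x" "z = d + s *\<^sub>R x" "c \<in> C" "d \<in> C" "0 \<le> t" "0 \<le> s"
    by blast
  then have "y + z = (c + d) + (t + s) *\<^sub>R x" "c + d \<in> C" "0 \<le> t + s"
    using pointed_cone_add[OF C] by (auto simp: algebra_simps)
  then show "y + z \<in> ?D" by blast
next
  fix y and a :: real assume "y \<in> ?D" "0 < a"
  then obtain c t where "y = c + t *\<^sub>R x" "c \<in> C" "0 \<le> t" by blast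
  then have "a *\<^sub>R y = a *\<^sub>R c + (a * t) *\<^sub>R x" "a *\<^sub>R c \<in> C" "0 \<le> a * t"
    using pointed_cone_scaleR[OF C] \<open>0 < a\<close> by (auto simp: algebra_simps)
  then show "a *\<^sub>R y \<in> ?D" by blast
next
  fix y assume "y \<in> ?D" "- y \<in> ?D"
  then obtain c t d s where y: "y = c + t *\<^sub>R x" "- y = d + s *\<^sub>R x"
    and cd: "c \<in> C" "d \<in> C" "0 \<le> t" "0 \<le> s"
    by blast
  have "(c + t *\<^sub>R x) + (d + s *\<^sub>R x) = 0" using y by (metis add.right_inverse)
  then have "(c + d) + (t + s) *\<^sub>R x = 0" by (simp add: algebra_simps)
  then have sum: "(t + s) *\<^sub>R (- x) = c + d" by (simp add: add_eq_0_iff2)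
  have "t + s = 0"
  proof (rule ccontr)
    assume "t + s \<noteq> 0"
    then have "- x = inverse (t + s) *\<^sub>R (c + d)" by (simp flip: sum)
    with x show False
      using cd pointed_cone_scaleR[OF C pointed_cone_add[OF C]] by simp
  qed
  with cd have "t = 0" "s = 0" by auto
  with y cd show "y = 0" using pointed_cone_eq_zero[OF C] by simp
qed

text \<open>Each closure condition involves at most two elements, and any two lie in a common member
  of the chain.\<close>

lemma pointed_cone_Union_chain:
  assumes ne: "\<C> \<noteq> {}" and chain: "subset.chain {C. pointed_cone C \<and> A \<subseteq> C} \<C>"
  shows "pointed_cone (\<Union>\<C>)"
proof -
  have cone: "pointed_cone C" if "C \<in> \<C>" for C
    using chain that unfolding subset_chain_def by auto
  have join: "\<exists>C\<in>\<C>. x \<in> C \<and> y \<in> C" if "x \<in> \<Union>\<C>" "y \<in> \<Union>\<C>" for x y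
  proof -
    from that obtain C D where "C \<in> \<C>" "D \<in> \<C>" "x \<in> C" "y \<in> D" by blast
    moreover from this have "C \<subseteq> D \<or> D \<subseteq> C" using chain unfolding subset_chain_def by blast
    ultimately show ?thesis by blast
  qed
  show ?thesis
    unfolding pointed_cone_def
  proof (intro conjI ballI allI impI)
    show "0 \<in> \<Union>\<C>" using ne cone pointed_cone_zero by blast
    show "x + y \<in> \<Union>\<C>" if "x \<in> \<Union>\<C>" "y \<in> \<Union>\<C>" for x y
      using join[OF that] cone pointed_cone_add by (metis UnionI)
    show "t *\<^sub>R x \<in> \<Union>\<C>" if "x \<in> \<Union>\<C>" "0 < t" for x t
      using that cone pointed_cone_scaleR[of _ x t] by (auto simp: less_imp_le)
    show "x = 0" if "x \<in> \<Union>\<C>" "- x \<in> \<Union>\<C>" for x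
      using join[OF that] cone pointed_cone_eq_zero by metis
  qed
qed

text \<open>A cone maximal above \<open>A\<close> is total: if \<open>- x \<notin> M\<close>,
  adjoining the ray through \<open>x\<close> gives a pointed cone again, which must equal
  \<open>M\<close>.\<close>

lemma pointed_cone_extend_total:
  assumes A: "pointed_cone A"
  obtains C where "pointed_cone C" "A \<subseteq> C" "\<And>x. x \<in> C \<or> - x \<in> C"
proof -
  let ?S = "{C. pointed_cone C \<and> A \<subseteq> C}"
  have "\<exists>M\<in>?S. \<forall>X\<in>?S. M \<subseteq> X \<longrightarrow> X = M"
  proof (rule subset_Zorn_nonempty)
    show "?S \<noteq> {}" using A by auto
    show "\<Union>\<C> \<in> ?S" if "\<C> \<noteq> {}" "subset.chain ?S \<C>" for \<C>
      using that(1) pointed_cone_Union_chain[OF that] that(2) unfolding subset_chain_def by blast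
  qed
  then obtain M where "M \<in> ?S" and max_S: "\<forall>X\<in>?S. M \<subseteq> X \<longrightarrow> X = M" ..
  then have M: "pointed_cone M" "A \<subseteq> M" by simp_all
  have max: "X = M" if "pointed_cone X" "M \<subseteq> X" for X
    using max_S that M(2) by simp
  have "x \<in> M" if "- x \<notin> M" for x
  proof -
    let ?D = "{c + t *\<^sub>R x | c t. c \<in> M \<and> 0 \<le> t}"
    have "M \<subseteq> ?D" by force
    then have "?D = M" by (rule max[OF pointed_cone_insert_direction[OF M(1) that]])
    moreover have "0 + 1 *\<^sub>R x \<in> ?D" using pointed_cone_zero[OF M(1)] zero_le_one by blast
    ultimately show ?thesis by simp
  qed
  with M show thesis using that by blast
qed

section \<open>The pricing of a total cone\<close>

text \<open>Positive real cuts suffice by density: a lower cut at 0 is trivial, and an upper cut is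
  never 0 and trivial at \<open>top\<close>. Restricting to \<open>t > 0\<close> allows division by
  \<open>t\<close> later.\<close>

lemma ennreal_eq_by_cuts:
  fixes x y :: ennreal
  assumes lower: "\<And>t. 0 < t \<Longrightarrow> ennreal t < x \<Longrightarrow> ennreal t \<le> y"
    and upper: "\<And>t. 0 < t \<Longrightarrow> x < ennreal t \<Longrightarrow> y \<le> ennreal t"
  shows "x = y"
proof (rule antisym)
  show "x \<le> y"
  proof (rule dense_le)
    fix z assume "z < x"
    then show "z \<le> y" using lower by (cases z; cases "z = 0") auto
  qed
  show "y \<le> x"
  proof (rule dense_ge)
    fix z assume "x < z"
    then show "y \<le> z" using upper by (cases z; cases "z = 0") auto
  qed
qed

lemma ennreal_inverse_inverse: "inverse (inverse x) = (x :: ennreal)"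
proof (cases "x = 0 \<or> x = top")
  case False
  then obtain a where "x = ennreal a" "0 < a" by (cases x) (auto simp: less_le)
  then show ?thesis by (simp add: inverse_ennreal)
qed auto

lemma ennreal_inverse_le_iff: "inverse x \<le> inverse y \<longleftrightarrow> y \<le> (x :: ennreal)"
proof -
  have "inverse a \<le> inverse b" if "b \<le> a" for a b :: ennreal
    using that unfolding less_eq_ennreal.rep_eq inverse_ennreal.rep_eq
    by (intro ereal_inverse_antimono) simp_all
  then show ?thesis using ennreal_inverse_inverse by metis
qed

text \<open>At \<open>u = v = 0\<close> every \<open>t\<close> is admissible and the supremum would
  be \<open>top\<close>, so the value 1 demanded by (VP3) is set by hand.\<close>

definition cone_price :: "'a::real_vector set \<Rightarrow> 'a \<Rightarrow> 'a \<Rightarrow> ennreal" where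
  "cone_price C u v =
     (if u = 0 \<and> v = 0 then 1 else SUP t\<in>{t. 0 \<le> t \<and> u - t *\<^sub>R v \<in> C}. ennreal t)"

locale total_cone =
  fixes C :: "'a::real_vector set"
  assumes pointed: "pointed_cone C" and total: "x \<in> C \<or> - x \<in> C"
begin

lemmas zero = pointed_cone_zero[OF pointed]
  and add = pointed_cone_add[OF pointed]
  and scaleR = pointed_cone_scaleR[OF pointed]
  and eq_zero = pointed_cone_eq_zero[OF pointed]

lemma price_ge:
  assumes "0 \<le> t" "u - t *\<^sub>R v \<in> C" "u \<noteq> 0 \<or> v \<noteq> 0"
  shows "ennreal t \<le> cone_price C u v"
  using assms unfolding cone_price_def by (auto intro!: SUP_upper2[of t])

text \<open>An admissible \<open>s > t\<close> would give
  \<open>(t - s) *\<^sub>R v \<in> C\<close>, hence \<open>- v \<in> C\<close>, against pointedness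
  and \<open>v \<noteq> 0\<close>.\<close>

lemma price_le:
  assumes "0 \<le> t" "t *\<^sub>R v - u \<in> C" "v \<in> C" "v \<noteq> 0"
  shows "cone_price C u v \<le> ennreal t"
proof -
  have "s \<le> t" if "u - s *\<^sub>R v \<in> C" for s
  proof (rule ccontr)
    assume "\<not> s \<le> t"
    have "(t - s) *\<^sub>R v \<in> C"
      using add[OF assms(2) that] by (simp add: algebra_simps)
    from scaleR[OF this, of "inverse (s - t)"]
    have "inverse (s - t) *\<^sub>R ((t - s) *\<^sub>R v) \<in> C" using \<open>\<not> s \<le> t\<close> by simp
    moreover have "inverse (s - t) * (t - s) = - 1" using \<open>\<not> s \<le> t\<close> by (simp add: field_simps)
    ultimately have "- v \<in> C" by simp
    with assms show False using eq_zero by blast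
  qed
  then show ?thesis
    using assms unfolding cone_price_def by (auto intro!: SUP_least ennreal_leI)
qed

text \<open>The strict inequality yields an admissible \<open>s > t\<close>; adding a nonnegative
  multiple of \<open>v\<close> moves from \<open>s\<close> down to \<open>t\<close>.\<close>

lemma diff_in_cone_if_less_price:
  assumes "0 \<le> t" "ennreal t < cone_price C u v" "v \<in> C" "u \<noteq> 0 \<or> v \<noteq> 0"
  shows "u - t *\<^sub>R v \<in> C"
proof -
  from assms(2,4) obtain s where s: "u - s *\<^sub>R v \<in> C" "ennreal t < ennreal s"
    unfolding cone_price_def by (auto simp: less_SUP_iff split: if_splits)
  then have "t < s" using assms(1) ennreal_less_iff by blast
  then have "(u - s *\<^sub>R v) + (s - t) *\<^sub>R v \<in> C" using s assms by (intro add scaleR) auto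
  then show ?thesis by (simp add: algebra_simps)
qed

text \<open>Here totality enters: \<open>t\<close> exceeds the supremum, so
  \<open>u - t *\<^sub>R v\<close> is outside \<open>C\<close> and its negative is inside.\<close>

lemma diff_in_cone_if_price_less:
  assumes "0 \<le> t" "cone_price C u v < ennreal t" "u \<noteq> 0 \<or> v \<noteq> 0"
  shows "t *\<^sub>R v - u \<in> C"
  using price_ge[of t u v] total[of "u - t *\<^sub>R v"] assms by (auto simp: not_le)

lemma price_zero_left: "v \<in> C \<Longrightarrow> v \<noteq> 0 \<Longrightarrow> cone_price C 0 v = 0"
  using price_le[of 0 v 0] zero by simp

lemma price_zero_right:
  assumes "u \<in> C" "u \<noteq> 0" shows "cone_price C u 0 = top"
proof -
  have "ennreal (real n) \<le> cone_price C u 0" for n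
    using price_ge[of "real n" u 0] assms by simp
  then show ?thesis
    by (metis ennreal_Ex_less_of_nat ennreal_of_nat_eq_real_of_nat leD top.not_eq_extremum)
qed

lemma price_self: "u \<in> C \<Longrightarrow> cone_price C u u = 1"
  using price_ge[of 1 u u] price_le[of 1 u u] zero
  by (cases "u = 0") (auto simp: cone_price_def intro: antisym)

text \<open>Dividing by \<open>t > 0\<close> turns a cut of \<open>u\<close> against
  \<open>v\<close> at \<open>t\<close> into a cut of \<open>v\<close> against \<open>u\<close> at
  \<open>inverse t\<close>. With a zero argument the values are 0, 1 and \<open>top\<close>, and
  \<open>inverse\<close> exchanges 0 and \<open>top\<close>.\<close>

lemma price_swap:
  assumes "u \<in> C" "v \<in> C"
  shows "inverse (cone_price C u v) = cone_price C v u"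
proof (cases "u = 0 \<or> v = 0")
  case True
  then show ?thesis
    using assms price_zero_left price_zero_right price_self by (cases "u = 0"; cases "v = 0") auto
next
  case False
  have "cone_price C u v = inverse (cone_price C v u)"
  proof (rule ennreal_eq_by_cuts)
    fix t :: real assume t: "0 < t" "ennreal t < cone_price C u v"
    then have "inverse t *\<^sub>R (u - t *\<^sub>R v) \<in> C"
      using False assms by (intro scaleR diff_in_cone_if_less_price) auto
    then have "inverse t *\<^sub>R u - v \<in> C" using t by (simp add: algebra_simps)
    then have "cone_price C v u \<le> inverse (ennreal t)"
      using price_le[of "inverse t" u v] t False assms by (simp add: inverse_ennreal)
    then show "ennreal t \<le> inverse (cone_price C v u)"
      by (metis ennreal_inverse_le_iff ennreal_inverse_inverse)
  next
    fix t :: real assume t: "0 < t" "cone_price C u v < ennreal t"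
    then have "inverse t *\<^sub>R (t *\<^sub>R v - u) \<in> C"
      using False by (intro scaleR diff_in_cone_if_price_less) auto
    then have "v - inverse t *\<^sub>R u \<in> C" using t by (simp add: algebra_simps)
    then have "inverse (ennreal t) \<le> cone_price C v u"
      using price_ge[of "inverse t" v u] t False by (simp add: inverse_ennreal)
    then show "inverse (cone_price C v u) \<le> ennreal t"
      by (metis ennreal_inverse_le_iff ennreal_inverse_inverse)
  qed
  then show ?thesis by (simp add: ennreal_inverse_inverse)
qed

text \<open>Adding admissible scalars gives one inequality; the other needs upper cuts and therefore
  totality.\<close>

lemma price_add:
  assumes "u \<in> C" "v \<in> C" "w \<in> C" "w \<noteq> 0"
  shows "cone_price C (u + v) w = cone_price C u w + cone_price C v w"
proof (rule antisym)
  let ?S = "\<lambda>u. {t. 0 \<le> t \<and> u - t *\<^sub>R w \<in> C}"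
  \<comment> \<open>Nonempty index sets are required to move a summand into a supremum; 0 is always
    admissible.\<close>
  have ne: "?S u \<noteq> {}" "?S v \<noteq> {}" using assms by (auto intro: exI[of _ 0])
  have "cone_price C u w + cone_price C v w =
      (SUP s\<in>?S u. SUP t\<in>?S v. ennreal s + ennreal t)"
    using ne assms(4)
    by (simp add: cone_price_def ennreal_SUP_add_left[symmetric] ennreal_SUP_add_right[symmetric])
  also have "\<dots> \<le> cone_price C (u + v) w"
  proof (intro SUP_least)
    fix s t assume st: "s \<in> ?S u" "t \<in> ?S v"
    then have "(u - s *\<^sub>R w) + (v - t *\<^sub>R w) \<in> C" by (intro add) auto
    then have "(u + v) - (s + t) *\<^sub>R w \<in> C" by (simp add: algebra_simps)
    then show "ennreal s + ennreal t \<le> cone_price C (u + v) w"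
      using price_ge[of "s + t" "u + v" w] st assms by simp
  qed
  finally show "cone_price C u w + cone_price C v w \<le> cone_price C (u + v) w" .
  show "cone_price C (u + v) w \<le> cone_price C u w + cone_price C v w"
  proof (rule ennreal_le_epsilon)
    fix e :: real assume e: "0 < e" and fin: "cone_price C u w + cone_price C v w < top"
    from fin obtain a b where ab: "0 \<le> a" "0 \<le> b" "cone_price C u w = ennreal a" "cone_price C v w = ennreal b"
      by (cases "cone_price C u w"; cases "cone_price C v w") auto
    \<comment> \<open>The excess \<open>e\<close> is shared equally, so that both coefficients lie
      strictly above the prices.\<close>
    have "(a + e/2) *\<^sub>R w - u \<in> C" "(b + e/2) *\<^sub>R w - v \<in> C"
      using ab e assms by (intro diff_in_cone_if_price_less; simp add: ennreal_less_iff)+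
    from add[OF this] have "(a + b + e) *\<^sub>R w - (u + v) \<in> C"
      by (simp add: algebra_simps flip: scaleR_add_left)
    then show "cone_price C (u + v) w \<le> cone_price C u w + cone_price C v w + ennreal e"
      using price_le[of "a + b + e" w "u + v"] ab e assms by simp
  qed
qed

text \<open>With the library convention \<open>0 * \<infinity> = 0\<close> the inequality holds without any definedness condition.\<close>

lemma price_mult_le:
  assumes "u \<in> C" "v \<in> C" "w \<in> C"
  shows "cone_price C u v * cone_price C v w \<le> cone_price C u w"
proof -
  \<comment> \<open>The first six cases contain a zero vector, and their prices are known. In the
    first and the sixth the product is the formal 0 times \<open>top\<close>, evaluated as
    0.\<close>
  consider "u = 0" "w = 0" "v \<noteq> 0" | "u = 0" "v = 0" | "v = 0" "w = 0" | "u = 0" "w \<noteq> 0" "v \<noteq> 0"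
    | "w = 0" "u \<noteq> 0" | "v = 0" "u \<noteq> 0" "w \<noteq> 0" | "u \<noteq> 0" "v \<noteq> 0" "w \<noteq> 0" by blast
  then show ?thesis
  proof cases
    case 7
    let ?S = "\<lambda>u v. {t. 0 \<le> t \<and> u - t *\<^sub>R v \<in> C}"
    have "cone_price C u v = (SUP s\<in>?S u v. ennreal s)" "cone_price C v w = (SUP t\<in>?S v w. ennreal t)"
      using 7 by (simp_all add: cone_price_def)
    then have "cone_price C u v * cone_price C v w =
        (SUP s\<in>?S u v. SUP t\<in>?S v w. ennreal s * ennreal t)"
      by (simp only: SUP_mult_right_ennreal) (simp only: SUP_mult_left_ennreal)
    also have "\<dots> \<le> cone_price C u w"
    proof (intro SUP_least)
      fix s t assume st: "s \<in> ?S u v" "t \<in> ?S v w"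
      \<comment> \<open>The terms in \<open>v\<close> cancel, leaving
        \<open>u - (s * t) *\<^sub>R w\<close>.\<close>
      then have "(u - s *\<^sub>R v) + s *\<^sub>R (v - t *\<^sub>R w) \<in> C" by (intro add scaleR) auto
      then have "u - (s * t) *\<^sub>R w \<in> C" by (simp add: algebra_simps)
      then show "ennreal s * ennreal t \<le> cone_price C u w"
        using price_ge[of "s * t" u w] st 7 by (simp add: ennreal_mult)
    qed
    finally show ?thesis .
  qed (use assms price_self zero price_zero_left price_zero_right in auto)
qed

text \<open>The missing inequality is \<open>price_mult_le\<close> for the reversed triple
  \<open>w, v, u\<close>, inverted through \<open>price_swap\<close>. Definedness is what makes
  \<open>inverse\<close> multiplicative here.\<close>

lemma price_mult:
  assumes "u \<in> C" "v \<in> C" "w \<in> C"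
    and "mult_defined (cone_price C u v) (cone_price C v w)"
  shows "cone_price C u w = cone_price C u v * cone_price C v w"
proof (rule antisym)
  have "inverse (cone_price C u v * cone_price C v w) =
      inverse (cone_price C u v) * inverse (cone_price C v w)"
    using assms(4) unfolding mult_defined_def
    by (intro ennreal_inverse_mult') (auto simp: less_top zero_less_iff_neq_zero)
  also have "\<dots> = cone_price C w v * cone_price C v u"
    using assms price_swap by (simp add: mult.commute)
  also have "\<dots> \<le> cone_price C w u" using assms by (intro price_mult_le)
  also have "\<dots> = inverse (cone_price C u w)" using assms price_swap by simp
  finally show "cone_price C u w \<le> cone_price C u v * cone_price C v w"
    by (metis ennreal_inverse_le_iff ennreal_inverse_inverse)
qed (use assms price_mult_le in auto)

end

lemma vector_pricing_cone_price:
  assumes "total_cone C" "pos_cone W \<subseteq> C"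
  shows "vector_pricing_on W (cone_price C)"
proof -
  interpret total_cone C by fact
  show ?thesis
    unfolding vector_pricing_on_def using assms(2) price_add price_mult price_self
    by (meson subsetD)
qed

section \<open>The cone of a pricing\<close>

text \<open>Cauchy's equation on the half-line. Nonnegative values make \<open>\<phi>\<close>
  monotone, which replaces continuity: the value at \<open>t\<close> is finite by comparison with an
  integer and is then pinned down by integer multiples of \<open>t\<close>.\<close>

lemma ennreal_additive_normalized:
  fixes \<phi> :: "real \<Rightarrow> ennreal"
  assumes add: "\<And>s t. 0 \<le> s \<Longrightarrow> 0 \<le> t \<Longrightarrow> \<phi> (s + t) = \<phi> s + \<phi> t"
    and one: "\<phi> 1 = 1" and t: "0 \<le> t"
  shows "\<phi> t = ennreal t"
proof -
  have "\<phi> 0 + 1 = 1" using add[of 0 1] one by simp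
  then have zero: "\<phi> 0 = 0" by (cases "\<phi> 0") (auto simp flip: ennreal_plus ennreal_1)
  have mono: "\<phi> s \<le> \<phi> t" if "0 \<le> s" "s \<le> t" for s t
    using add[of s "t - s"] that by simp
  have mult: "\<phi> (real n * s) = of_nat n * \<phi> s" if "0 \<le> s" for n s
    using that zero by (induction n) (auto simp: add algebra_simps)
  have nat: "\<phi> (real n) = of_nat n" for n using mult[of 1 n] one by simp
  have "\<phi> t \<le> of_nat (nat \<lceil>t\<rceil>)" unfolding nat[symmetric] using t by (intro mono) (simp_all add: of_nat_ceiling)
  then obtain a where a: "0 \<le> a" "\<phi> t = ennreal a"
    by (cases "\<phi> t") (auto simp: top_unique)
  \<comment> \<open>Monotonicity places \<open>real n * a\<close> in the interval
    \<open>[k, k + 1]\<close> that contains \<open>real n * t\<close>.\<close>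
  have bound: "\<bar>a - t\<bar> * real n \<le> 1" for n
  proof -
    define k where "k = nat \<lfloor>real n * t\<rfloor>"
    have k: "real k \<le> real n * t" "real n * t \<le> real (Suc k)"
      using t unfolding k_def by (auto simp: floor_le_iff) linarith+
    have m: "\<phi> (real n * t) = ennreal (real n * a)"
      using mult[OF t, of n] a by (simp add: ennreal_mult flip: ennreal_of_nat_eq_real_of_nat)
    have "ennreal (real k) \<le> ennreal (real n * a)"
      using mono[of "real k" "real n * t"] k nat[of k] m by (simp add: ennreal_of_nat_eq_real_of_nat)
    moreover have "ennreal (real n * a) \<le> ennreal (real (Suc k))"
      using mono[of "real n * t" "real (Suc k)"] k nat[of "Suc k"] m t
      unfolding ennreal_of_nat_eq_real_of_nat by simp
    ultimately have "real k \<le> real n * a" "real n * a \<le> real (Suc k)"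
      using a by (simp_all add: ennreal_le_iff del: of_nat_Suc)
    with k have "\<bar>real n * (a - t)\<bar> \<le> 1" by (simp add: algebra_simps abs_le_iff)
    then show ?thesis by (simp add: abs_mult mult.commute)
  qed
  have "a = t"
  proof (rule ccontr)
    assume "a \<noteq> t"
    then obtain n where "1 < real n * \<bar>a - t\<bar>" using reals_Archimedean3[of "\<bar>a - t\<bar>"] by auto
    with bound[of n] show False by (simp add: mult.commute)
  qed
  with a show ?thesis by simp
qed

section \<open>Calculation rules for a pricing on a subspace\<close>

locale pricing =
  fixes W :: "'a::ordered_real_vector set" and r :: "'a \<Rightarrow> 'a \<Rightarrow> ennreal"
  assumes W: "subspace W" and r: "vector_pricing_on W r"
begin

abbreviation "P \<equiv> pos_cone W"

lemma P_zero: "0 \<in> P" and P_add: "u \<in> P \<Longrightarrow> v \<in> P \<Longrightarrow> u + v \<in> P"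
  and P_scaleR: "u \<in> P \<Longrightarrow> 0 \<le> t \<Longrightarrow> t *\<^sub>R u \<in> P"
  using W by (auto simp: pos_cone_def subspace_0 subspace_add subspace_scale scaleR_nonneg_nonneg)

lemma r_add: "u \<in> P \<Longrightarrow> v \<in> P \<Longrightarrow> w \<in> P \<Longrightarrow> w \<noteq> 0 \<Longrightarrow> r (u + v) w = r u w + r v w"
  and r_mult: "u \<in> P \<Longrightarrow> v \<in> P \<Longrightarrow> w \<in> P \<Longrightarrow> mult_defined (r u v) (r v w) \<Longrightarrow> r u w = r u v * r v w"
  and r_self: "u \<in> P \<Longrightarrow> r u u = 1"
  using r unfolding vector_pricing_on_def by blast+

lemma r_zero_left:
  assumes "w \<in> P" "w \<noteq> 0" shows "r 0 w = 0"
proof -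
  have "r 0 w + 1 = 1" using r_add[of 0 w w] assms P_zero r_self by simp
  then show ?thesis by (cases "r 0 w") (auto simp flip: ennreal_plus ennreal_1)
qed

text \<open>If \<open>r w 0\<close> were finite, the product \<open>r 0 w * r w 0\<close> would be
  defined and 0, whereas (VP2) makes it \<open>r 0 0 = 1\<close>.\<close>

lemma r_zero_right:
  assumes "w \<in> P" "w \<noteq> 0" shows "r w 0 = top"
  using r_mult[of 0 w 0] r_self[of 0] r_zero_left[OF assms] assms P_zero
  by (auto simp: mult_defined_def)

lemma r_swap_less:
  assumes "u \<in> P" "v \<in> P" "r u v < top" shows "r u v * r v u = 1 \<or> r u v = 0 \<and> r v u = top"
  using r_mult[of u v u] r_self[of u] assms unfolding mult_defined_def by force

text \<open>Homogeneity is not an axiom; it comes from additivity in the first argument. Since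
  \<open>t > 0\<close> is neither 0 nor \<open>top\<close>, (VP2) then applies freely in the two
  scaling rules that follow.\<close>

lemma r_scaleR_self:
  assumes "u \<in> P" "u \<noteq> 0" "0 \<le> t" shows "r (t *\<^sub>R u) u = ennreal t"
  using assms by (intro ennreal_additive_normalized[of "\<lambda>t. r (t *\<^sub>R u) u"])
    (auto simp: scaleR_add_left r_add P_scaleR r_self)

lemma r_scaleR_left:
  assumes "u \<in> P" "v \<in> P" "u \<noteq> 0" "0 < t" shows "r (t *\<^sub>R u) v = ennreal t * r u v"
  using r_mult[of "t *\<^sub>R u" u v] r_scaleR_self[of u t] assms P_scaleR
  by (simp add: mult_defined_def)

lemma r_scaleR_right:
  assumes "u \<in> P" "v \<in> P" "v \<noteq> 0" "0 < t" shows "ennreal t * r u (t *\<^sub>R v) = r u v"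
proof -
  have "mult_defined (r u (t *\<^sub>R v)) (r (t *\<^sub>R v) v)"
    using r_scaleR_self[of v t] assms by (simp add: mult_defined_def)
  then show ?thesis
    using r_mult[of u "t *\<^sub>R v" v] r_scaleR_self[of v t] assms P_scaleR
    by (simp add: mult.commute)
qed

lemma one_less_r_scaleR_right:
  assumes "u \<in> P" "v \<in> P" "v \<noteq> 0" "0 < t" "ennreal t < r u v"
  shows "1 < r u (t *\<^sub>R v)"
proof -
  have "ennreal t * 1 < ennreal t * r u (t *\<^sub>R v)" using assms r_scaleR_right by simp
  moreover have "ennreal t * r u (t *\<^sub>R v) \<le> ennreal t * 1" if "r u (t *\<^sub>R v) \<le> 1"
    using that by (rule mult_left_mono) simp
  ultimately show ?thesis by (meson leD leI)
qed

text \<open>All four vectors are priced against \<open>s = v + v'\<close>. The prices of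
  \<open>v\<close> and \<open>v'\<close> sum to 1, and (VP2) shows that replacing \<open>v\<close>
  by \<open>u\<close> and \<open>v'\<close> by \<open>u'\<close> raises each nonzero price, so the
  new sum exceeds 1.\<close>

lemma one_less_r_add:
  assumes P: "u \<in> P" "v \<in> P" "u' \<in> P" "v' \<in> P" and gt: "1 < r u v" "1 < r u' v'"
  shows "1 < r (u + u') (v + v')"
proof (cases "v + v' = 0")
  case True
  then have "v = 0" using P by (simp add: pos_cone_def add_nonneg_eq_0_iff)
  with gt(1) have "u \<noteq> 0" using r_self[OF P_zero] by auto
  then have "u + u' \<noteq> 0" using P by (simp add: pos_cone_def add_nonneg_eq_0_iff)
  then show ?thesis using True P r_zero_right[OF P_add] by simp
next
  case False
  define s where "s = v + v'"
  have s: "s \<in> P" "s \<noteq> 0" using False P P_add s_def by auto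
  have sum: "r v s + r v' s = 1" using r_add[of v v' s] P s r_self s_def by simp
  \<comment> \<open>Excluding \<open>r b s = 0\<close> and \<open>r b s = top\<close> makes the
    product in (VP2) defined and multiplication strict.\<close>
  have less: "r b s < r a s" if "a \<in> P" "b \<in> P" "1 < r a b" "r b s \<noteq> 0" "r b s \<le> 1" for a b
  proof -
    have fin: "r b s < top" using that(5) le_less_trans ennreal_one_less_top by blast
    then have "mult_defined (r a b) (r b s)" using that by (auto simp: mult_defined_def)
    then have "r a s = r a b * r b s" using that s by (intro r_mult)
    then show ?thesis
      using ennreal_mult_strict_right_mono[of 1 "r a b" "r b s"] that fin
      by (simp add: zero_less_iff_neq_zero)
  qed
  have le: "r v s \<le> 1" "r v' s \<le> 1" using sum by (metis le_iff_add add.commute)+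
  have leq: "r v s \<le> r u s" "r v' s \<le> r u' s"
    using less[of u v] less[of u' v'] P gt le by (cases "r v s = 0"; cases "r v' s = 0"; simp)+
  have fin: "r v s < top" "r v' s < top" using le le_less_trans ennreal_one_less_top by blast+
  have strict: "a + b < c + d" if "a < c" "b \<le> d" "b < top" for a b c d :: ennreal
  proof -
    have "a + b < c + b" using that by (simp add: ennreal_add_left_cancel_less add.commute[of _ b] less_top)
    also have "\<dots> \<le> c + d" using that by (simp add: add_left_mono)
    finally show ?thesis .
  qed
  \<comment> \<open>The prices sum to 1, so at least one is nonzero and supplies the strict
    inequality.\<close>
  have "r v s + r v' s < r u s + r u' s"
  proof (cases "r v s = 0")
    case True
    then have "r v' s < r u' s" using less[of u' v'] P gt le sum by auto
    from strict[OF this leq(1) fin(1)] show ?thesis by (simp add: add.commute)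
  next
    case False
    then have "r v s < r u s" using less[of u v] P gt le by auto
    from strict[OF this leq(2) fin(2)] show ?thesis .
  qed
  then show ?thesis using sum r_add[of u u' s] P s s_def by simp
qed

text \<open>For nonzero vectors the two factors \<open>t\<close> cancel, so the price itself is
  unchanged.\<close>

lemma one_less_r_scaleR:
  assumes "u \<in> P" "v \<in> P" "0 < t" "1 < r u v"
  shows "1 < r (t *\<^sub>R u) (t *\<^sub>R v)"
proof (cases "v = 0")
  case True
  then have "u \<noteq> 0" using assms r_self by auto
  then show ?thesis using True assms r_zero_right[OF P_scaleR] by simp
next
  case False
  then have "u \<noteq> 0" using assms r_zero_left by auto
  then show ?thesis
    using r_scaleR_left[of u "t *\<^sub>R v" t] r_scaleR_right[of u v t] False assms P_scaleR by simp
qed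

text \<open>If \<open>u \<le> v\<close> with \<open>v \<noteq> 0\<close>, then \<open>v - u\<close>
  is in \<open>P\<close> and \<open>r u v + r (v - u) v = 1\<close>.\<close>

lemma one_less_r_imp_not_le:
  assumes "u \<in> P" "v \<in> P" "1 < r u v" shows "\<not> u \<le> v"
proof
  assume "u \<le> v"
  show False
  proof (cases "v = 0")
    case True
    then have "u = 0" using assms \<open>u \<le> v\<close> by (simp add: pos_cone_def)
    with True assms show False using r_self by auto
  next
    case False
    have "v - u \<in> P" using assms \<open>u \<le> v\<close> W by (simp add: pos_cone_def subspace_diff)
    then have "r u v + r (v - u) v = 1" using r_add[of u "v - u" v] False assms r_self by simp
    then have "r u v \<le> 1" by (metis le_iff_add)
    with assms show False by simp
  qed
qed

section \<open>The cone generated by a pricing\<close>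

text \<open>One difference per element is enough, because \<open>one_less_r_add\<close> merges two
  into one. The first set is listed separately since there may be no pair with
  \<open>1 < r u v\<close>, as for \<open>W = {0}\<close>.\<close>

definition price_cone :: "'a set" where
  "price_cone = {w. 0 \<le> w} \<union> {u - v + w | u v w. u \<in> P \<and> v \<in> P \<and> 1 < r u v \<and> 0 \<le> w}"

lemma price_cone_cases:
  assumes "x \<in> price_cone"
  obtains "0 \<le> x" | u v w where "x = u - v + w" "u \<in> P" "v \<in> P" "1 < r u v" "0 \<le> w"
  using assms unfolding price_cone_def by auto

lemma price_cone_nonneg: "0 \<le> x \<Longrightarrow> x \<in> price_cone"
  and price_coneI: "x = u - v + w \<Longrightarrow> u \<in> P \<Longrightarrow> v \<in> P \<Longrightarrow> 1 < r u v \<Longrightarrow> 0 \<le> w \<Longrightarrow> x \<in> price_cone"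
  unfolding price_cone_def by blast+

lemma price_cone_add:
  assumes "x \<in> price_cone" "y \<in> price_cone" shows "x + y \<in> price_cone"
  using assms(1)
proof (cases rule: price_cone_cases)
  case 1
  from assms(2) show ?thesis
  proof (cases rule: price_cone_cases)
    case 1 with \<open>0 \<le> x\<close> show ?thesis by (simp add: price_cone_nonneg)
  next
    case (2 u v w)
    with \<open>0 \<le> x\<close> show ?thesis by (intro price_coneI[of _ u v "w + x"]) auto
  qed
next
  case x: (2 u v w)
  from assms(2) show ?thesis
  proof (cases rule: price_cone_cases)
    case 1
    with x show ?thesis by (intro price_coneI[of _ u v "w + y"]) auto
  next
    case (2 u' v' w')
    with x show ?thesis
      by (intro price_coneI[of _ "u + u'" "v + v'" "w + w'"] P_add one_less_r_add) auto
  qed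
qed

lemma pointed_price_cone: "pointed_cone price_cone"
  unfolding pointed_cone_def
proof (intro conjI ballI allI impI)
  show "0 \<in> price_cone" by (simp add: price_cone_nonneg)
next
  fix x and t :: real assume "x \<in> price_cone" and t: "0 < t"
  then show "t *\<^sub>R x \<in> price_cone"
  proof (cases rule: price_cone_cases)
    case 1
    with t show ?thesis by (simp add: price_cone_nonneg scaleR_nonneg_nonneg)
  next
    case (2 u v w)
    with t show ?thesis
      by (intro price_coneI[of _ "t *\<^sub>R u" "t *\<^sub>R v" "t *\<^sub>R w"] P_scaleR one_less_r_scaleR)
        (auto simp: scaleR_add_right scaleR_diff_right scaleR_nonneg_nonneg)
  qed
next
  fix x assume x: "x \<in> price_cone" "- x \<in> price_cone"
  \<comment> \<open>If \<open>y\<close> involved a difference, cancelling it against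
    \<open>- y\<close> would give \<open>u \<le> v\<close> or \<open>u + u' \<le> v + v'\<close> for
    a pair of price above 1. So \<open>x\<close> and \<open>- x\<close> are both
    nonnegative.\<close>
  have ge: "0 \<le> y" if "y \<in> price_cone" "- y \<in> price_cone" for y
    using that(1)
  proof (cases rule: price_cone_cases)
    case y: (2 u v w)
    from that(2) have False
    proof (cases rule: price_cone_cases)
      case 1
      then have "u + w \<le> v" using y by (simp add: algebra_simps)
      then show False using y one_less_r_imp_not_le[of u v] by (metis add_increasing2 order_trans order_refl)
    next
      case (2 u' v' w')
      have "- (u - v + w) = u' - v' + w'" using 2 y by simp
      then have "v + v' = (u + u') + (w + w')" by (simp add: algebra_simps)
      then have "u + u' \<le> v + v'" using 2 y by simp
      then show False
        using one_less_r_imp_not_le[OF P_add P_add one_less_r_add] y 2 by blast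
    qed
    then show ?thesis ..
  qed
  from ge[OF x] ge[of "- x"] x show "x = 0" by simp
qed (rule price_cone_add)

lemma cone_price_eq:
  assumes "total_cone C" and sub: "price_cone \<subseteq> C" and P: "u \<in> P" "v \<in> P"
  shows "cone_price C u v = r u v"
proof -
  interpret total_cone C by fact
  have C: "u \<in> C" "v \<in> C" using P sub price_cone_nonneg by (auto simp: pos_cone_def)
  have mem: "a - b \<in> C" if "a \<in> P" "b \<in> P" "1 < r a b" for a b
    using price_coneI[of "a - b" a b 0] that sub by auto
  show ?thesis
  proof (cases "u = 0 \<or> v = 0")
    case True
    then show ?thesis
      using C P price_zero_left price_zero_right price_self r_zero_left r_zero_right r_self
      by (cases "u = 0"; cases "v = 0") auto
  next
    case False
    have "r u v = cone_price C u v"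
    proof (rule ennreal_eq_by_cuts)
      fix t :: real assume "0 < t" "ennreal t < r u v"
      then show "ennreal t \<le> cone_price C u v"
        using False P P_scaleR by (intro price_ge mem one_less_r_scaleR_right) auto
    next
      fix t :: real assume t: "0 < t" "r u v < ennreal t"
      then have "r u v < top" using less_trans ennreal_less_top by blast
      \<comment> \<open>The upper cut needs \<open>t *\<^sub>R v - u\<close> in the cone, hence a
        price above 1 in the opposite direction. Either \<open>r u v < t\<close> is multiplied by
        the reciprocal \<open>r v u\<close>, or \<open>r v u = top\<close>.\<close>
      from r_swap_less[OF P this] have "1 < ennreal t * r v u"
      proof
        assume eq: "r u v * r v u = 1"
        then have "0 < r v u" by (auto simp: zero_less_iff_neq_zero)
        moreover have "r v u < top" using eq
          by (cases "r v u = top") (auto simp: ennreal_mult_top less_top split: if_splits)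
        ultimately show ?thesis using ennreal_mult_strict_right_mono[OF t(2)] eq by metis
      qed (use t in \<open>simp add: ennreal_mult_top\<close>)
      then have "1 < r (t *\<^sub>R v) u" using r_scaleR_left[of v u t] False P t by simp
      then show "cone_price C u v \<le> ennreal t"
        using False P C t P_scaleR by (intro price_le mem) auto
    qed
    then show ?thesis ..
  qed
qed

lemma extension:
  "\<exists>r'. vector_pricing_on UNIV r' \<and> (\<forall>u\<in>P. \<forall>v\<in>P. r' u v = r u v)"
proof -
  obtain C where C: "pointed_cone C" "price_cone \<subseteq> C" "\<And>x. x \<in> C \<or> - x \<in> C"
    using pointed_cone_extend_total[OF pointed_price_cone] by metis
  then have total: "total_cone C" by unfold_locales auto
  have "pos_cone UNIV \<subseteq> C" using C(2) price_cone_nonneg by (auto simp: pos_cone_def)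
  with total C(2) show ?thesis using vector_pricing_cone_price cone_price_eq by blast
qed

end

theorem theorem1:
  shows "(\<exists>r :: 'a::ordered_real_vector \<Rightarrow> 'a \<Rightarrow> ennreal. vector_pricing_on UNIV r) \<and>
    (\<forall>(V0 :: 'a set) r0. subspace V0 \<longrightarrow> vector_pricing_on V0 r0 \<longrightarrow>
       (\<exists>r. vector_pricing_on UNIV r \<and>
            (\<forall>u \<in> pos_cone V0. \<forall>v \<in> pos_cone V0. r u v = r0 u v)))"
proof (intro conjI allI impI)
  \<comment> \<open>Existence is the extension of the trivial pricing on the zero subspace.\<close>
  have "pricing {0 :: 'a} (\<lambda>_ _. 1)"
    by unfold_locales (auto simp: subspace_def vector_pricing_on_def pos_cone_def)
  from pricing.extension[OF this] show "\<exists>r :: 'a \<Rightarrow> 'a \<Rightarrow> ennreal. vector_pricing_on UNIV r"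
    by blast
next
  fix V0 :: "'a set" and r0
  assume "subspace V0" "vector_pricing_on V0 r0"
  then have "pricing V0 r0" by unfold_locales
  then show "\<exists>r. vector_pricing_on UNIV r \<and>
      (\<forall>u \<in> pos_cone V0. \<forall>v \<in> pos_cone V0. r u v = r0 u v)"
    by (rule pricing.extension)
qed

end
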